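(* Let $A$ be an associative algebra and let $r,s$ be two skew-symmetric elements of $A^{\otimes2}$. Then $(r,s)$ is an associative Yang-Baxter pair if and only if $(r^\sharp,s^\sharp)$ is a generalized Rota-Baxter system on the coadjoint bimodule $A^*$ over the algebra $A$.
   Context: All vector spaces are over a field of characteristic zero. Summation is implicit in $r=r_{(1)}\otimes r_{(2)}$, $s=s_{(1)}\otimes s_{(2)}$. An element of $A^{\otimes 2}$ is skew-symmetric if the flip maps it to its negative. For such elements define in $A^{\otimes3}$: $r_{13}s_{12}=r_{(1)}s_{(1)}\otimes s_{(2)}\otimes r_{(2)}$, $r_{12}s_{23}=r_{(1)}\otimes r_{(2)}s_{(1)}\otimes s_{(2)}$, $r_{23}s_{13}=s_{(1)}\otimes r_{(1)}\otimes r_{(2)}s_{(2)}$ (and similarly with $r,s$ replaced by any pair of elements, using independent copies when they coincide). $(r,s)$ is an associative Yang-Baxter pair if $$r_{13}r_{12}-r_{12}r_{23}+s_{23}r_{13}=0,\qquad s_{13}r_{12}-s_{12}s_{23}+s_{23}s_{13}=0.$$ The linear maps $r^\sharp,s^\sharp:A^*\to A$ are $r^\sharp(\alpha)=\alpha(r_{(2)})r_{(1)}$, $s^\sharp(\alpha)=\alpha(s_{(2)})s_{(1)}$. The coadjoint bimodule is $A^*$ with $(a\cdot f)(b)=f(ba)$ and $(f\cdot a)(b)=f(ab)$. A generalized Rota-Baxter system on an $A$-bimodule $M$ over $A$ is a pair of linear maps $R,S:M\to A$ with $R(u)R(v)=R(R(u)\cdot v+u\cdot S(v))$ and $S(u)S(v)=S(R(u)\cdot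 v+u\cdot S(v))$ for all $u,v\in M$. *)

theory Defs
  imports Complex_Main "HOL-Library.Poly_Mapping" "HOL-Library.Function_Algebras"
begin

section \<open>Associative algebras and bimodules\<close>

text \<open>Associative algebras are not assumed to be unital; unital ones are the special case in which
  the ring type happens to have a unit.\<close>

locale assoc_algebra = vector_space scale
  for scale :: "'k::field_char_0 \<Rightarrow> 'a::ring \<Rightarrow> 'a" +
  assumes scale_mult_left: "scale c (a * b) = scale c a * b"
    and scale_mult_right: "scale c (a * b) = a * scale c b"

text \<open>The bimodule is the subspace \<open>M\<close> of the ambient vector space \<open>'m\<close>, so that spaces
  which are not a whole type, such as the dual of \<open>'a\<close>, are covered.\<close>

locale algebra_bimodule = assoc_algebra scale + V: vector_space mscale
  for scale :: "'k::field_char_0 \<Rightarrow> 'a::ring \<Rightarrow> 'a"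
    and mscale :: "'k \<Rightarrow> 'm::ab_group_add \<Rightarrow> 'm" +
  fixes M :: "'m set" and lact :: "'a \<Rightarrow> 'm \<Rightarrow> 'm" and ract :: "'m \<Rightarrow> 'a \<Rightarrow> 'm"
  assumes subspace_M: "V.subspace M"
    and lact_closed: "u \<in> M \<Longrightarrow> lact a u \<in> M"
    and ract_closed: "u \<in> M \<Longrightarrow> ract u a \<in> M"
    and lact_add_left: "u \<in> M \<Longrightarrow> lact (a + b) u = lact a u + lact b u"
    and lact_add_right: "u \<in> M \<Longrightarrow> v \<in> M \<Longrightarrow> lact a (u + v) = lact a u + lact a v"
    and lact_scale_left: "u \<in> M \<Longrightarrow> lact (scale c a) u = mscale c (lact a u)"
    and lact_scale_right: "u \<in> M \<Longrightarrow> lact a (mscale c u) = mscale c (lact a u)"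
    and ract_add_left: "u \<in> M \<Longrightarrow> v \<in> M \<Longrightarrow> ract (u + v) a = ract u a + ract v a"
    and ract_add_right: "u \<in> M \<Longrightarrow> ract u (a + b) = ract u a + ract u b"
    and ract_scale_left: "u \<in> M \<Longrightarrow> ract (mscale c u) a = mscale c (ract u a)"
    and ract_scale_right: "u \<in> M \<Longrightarrow> ract u (scale c a) = mscale c (ract u a)"
    and lact_mult: "u \<in> M \<Longrightarrow> lact (a * b) u = lact a (lact b u)"
    and ract_mult: "u \<in> M \<Longrightarrow> ract u (a * b) = ract (ract u a) b"
    and lact_ract: "u \<in> M \<Longrightarrow> ract (lact a u) b = lact a (ract u b)"
begin

definition linear_on_M :: "('m \<Rightarrow> 'a) \<Rightarrow> bool" where
  "linear_on_M T \<longleftrightarrow>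
     (\<forall>u\<in>M. \<forall>v\<in>M. T (u + v) = T u + T v) \<and> (\<forall>c. \<forall>u\<in>M. T (mscale c u) = scale c (T u))"

definition generalized_RB_system :: "('m \<Rightarrow> 'a) \<Rightarrow> ('m \<Rightarrow> 'a) \<Rightarrow> bool" where
  "generalized_RB_system R S \<longleftrightarrow>
     linear_on_M R \<and> linear_on_M S \<and>
     (\<forall>u\<in>M. \<forall>v\<in>M. R u * R v = R (lact (R u) v + ract u (S v))) \<and>
     (\<forall>u\<in>M. \<forall>v\<in>M. S u * S v = S (lact (R u) v + ract u (S v)))"

end

section \<open>The coadjoint bimodule\<close>

definition dual_space :: "('k::field \<Rightarrow> 'a::ring \<Rightarrow> 'a) \<Rightarrow> ('a \<Rightarrow> 'k) set" where
  "dual_space scale = {f. Vector_Spaces.linear scale (*) f}"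

definition dual_scale :: "'k::field \<Rightarrow> ('a \<Rightarrow> 'k) \<Rightarrow> ('a \<Rightarrow> 'k)" where
  "dual_scale c f = (\<lambda>x. c * f x)"

definition coadj_left :: "'a::ring \<Rightarrow> ('a \<Rightarrow> 'k) \<Rightarrow> ('a \<Rightarrow> 'k)" where
  "coadj_left a f = (\<lambda>b. f (b * a))"

definition coadj_right :: "('a::ring \<Rightarrow> 'k) \<Rightarrow> 'a \<Rightarrow> ('a \<Rightarrow> 'k)" where
  "coadj_right f a = (\<lambda>b. f (a * b))"

lemma (in assoc_algebra) mem_dual_space_iff:
  "f \<in> dual_space scale \<longleftrightarrow>
     (\<forall>x y. f (x + y) = f x + f y) \<and> (\<forall>c x. f (scale c x) = c * f x)"
proof -
  have "vector_space ((*) :: 'k \<Rightarrow> 'k \<Rightarrow> 'k)"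
    by unfold_locales (auto simp: algebra_simps)
  then show ?thesis
    using vector_space_axioms
    unfolding dual_space_def
    by (auto simp: Vector_Spaces.linear_def module_hom_def module_hom_axioms_def
        module_iff_vector_space)
qed

lemma (in assoc_algebra) coadjoint_bimodule:
  "algebra_bimodule scale dual_scale (dual_space scale) coadj_left coadj_right"
proof -
  interpret V: vector_space "dual_scale :: 'k \<Rightarrow> ('a \<Rightarrow> 'k) \<Rightarrow> _"
    by unfold_locales (auto simp: dual_scale_def algebra_simps fun_eq_iff)
  show ?thesis
    by unfold_locales
      (auto simp: mem_dual_space_iff V.subspace_def coadj_left_def coadj_right_def dual_scale_def
        fun_eq_iff algebra_simps scale_mult_left[symmetric] scale_mult_right[symmetric])
qed

section \<open>Tensor powers as quotients of free vector spaces\<close>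

text \<open>\<open>'b \<Rightarrow>\<^sub>0 'k\<close> is the free vector space on \<open>'b\<close>, with basis \<open>free_gen b\<close>;
  \<open>free_ext sc g\<close> is the linear extension of \<open>g\<close> to it, with \<open>sc\<close> the scalar
  multiplication of the target.\<close>

definition free_scale :: "'k::field \<Rightarrow> ('b \<Rightarrow>\<^sub>0 'k) \<Rightarrow> ('b \<Rightarrow>\<^sub>0 'k)" where
  "free_scale c x = Poly_Mapping.map ((*) c) x"

definition free_gen :: "'b \<Rightarrow> ('b \<Rightarrow>\<^sub>0 'k::field)" where
  "free_gen b = Poly_Mapping.single b 1"

definition free_ext ::
    "('k::field \<Rightarrow> 'v::ab_group_add \<Rightarrow> 'v) \<Rightarrow> ('b \<Rightarrow> 'v) \<Rightarrow> ('b \<Rightarrow>\<^sub>0 'k) \<Rightarrow> 'v" where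
  "free_ext sc g x = (\<Sum>b\<in>Poly_Mapping.keys x. sc (Poly_Mapping.lookup x b) (g b))"

definition bilinear_rels ::
    "('k::field \<Rightarrow> 'a::ab_group_add \<Rightarrow> 'a) \<Rightarrow> ('a \<times> 'a \<Rightarrow>\<^sub>0 'k) set" where
  "bilinear_rels scale =
     {free_gen (a + a', b) - free_gen (a, b) - free_gen (a', b) | a a' b. True} \<union>
     {free_gen (a, b + b') - free_gen (a, b) - free_gen (a, b') | a b b'. True} \<union>
     {free_gen (scale c a, b) - free_scale c (free_gen (a, b)) | c a b. True} \<union>
     {free_gen (a, scale c b) - free_scale c (free_gen (a, b)) | c a b. True}"

definition trilinear_rels ::
    "('k::field \<Rightarrow> 'a::ab_group_add \<Rightarrow> 'a) \<Rightarrow> ('a \<times> 'a \<times> 'a \<Rightarrow>\<^sub>0 'k) set" where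
  "trilinear_rels scale =
     {free_gen (a + a', b, c) - free_gen (a, b, c) - free_gen (a', b, c) | a a' b c. True} \<union>
     {free_gen (a, b + b', c) - free_gen (a, b, c) - free_gen (a, b', c) | a b b' c. True} \<union>
     {free_gen (a, b, c + c') - free_gen (a, b, c) - free_gen (a, b, c') | a b c c'. True} \<union>
     {free_gen (scale k a, b, c) - free_scale k (free_gen (a, b, c)) | k a b c. True} \<union>
     {free_gen (a, scale k b, c) - free_scale k (free_gen (a, b, c)) | k a b c. True} \<union>
     {free_gen (a, b, scale k c) - free_scale k (free_gen (a, b, c)) | k a b c. True}"

definition null2 ::
    "('k::field \<Rightarrow> 'a::ab_group_add \<Rightarrow> 'a) \<Rightarrow> ('a \<times> 'a \<Rightarrow>\<^sub>0 'k) set" where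
  "null2 scale = module.span free_scale (bilinear_rels scale)"

definition null3 ::
    "('k::field \<Rightarrow> 'a::ab_group_add \<Rightarrow> 'a) \<Rightarrow> ('a \<times> 'a \<times> 'a \<Rightarrow>\<^sub>0 'k) set" where
  "null3 scale = module.span free_scale (trilinear_rels scale)"

text \<open>Tensors are the cosets \<open>x + N\<close>, where \<open>N\<close> is \<open>null2 scale\<close> or \<open>null3 scale\<close>; the zero
  tensor is the coset \<open>N\<close> itself.\<close>

definition coset_of :: "'v::ab_group_add set \<Rightarrow> 'v \<Rightarrow> 'v set" where
  "coset_of N x = {y. y - x \<in> N}"

definition coset_add :: "'v::ab_group_add set \<Rightarrow> 'v set \<Rightarrow> 'v set"  (infixl "\<oplus>\<^sub>T" 65) where
  "X \<oplus>\<^sub>T Y = {x + y | x y. x \<in> X \<and> y \<in> Y}"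

definition coset_neg :: "'v::ab_group_add set \<Rightarrow> 'v set"  ("\<ominus>\<^sub>T _" [81] 80) where
  "\<ominus>\<^sub>T X = uminus ` X"

definition tensor2 ::
    "('k::field \<Rightarrow> 'a::ab_group_add \<Rightarrow> 'a) \<Rightarrow> ('a \<times> 'a \<Rightarrow>\<^sub>0 'k) set set" where
  "tensor2 scale = range (coset_of (null2 scale))"

text \<open>Maps out of \<open>tensor2 scale\<close> are defined on representatives; independence of the chosen
  representatives is proved at the end.\<close>

definition tensor_flip ::
    "('k::field \<Rightarrow> 'a::ab_group_add \<Rightarrow> 'a) \<Rightarrow>
       ('a \<times> 'a \<Rightarrow>\<^sub>0 'k) set \<Rightarrow> ('a \<times> 'a \<Rightarrow>\<^sub>0 'k) set" where
  "tensor_flip scale r =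
     (\<Union>x\<in>r. coset_of (null2 scale) (free_ext free_scale (\<lambda>(a, b). free_gen (b, a)) x))"

definition skew_symmetric ::
    "('k::field \<Rightarrow> 'a::ab_group_add \<Rightarrow> 'a) \<Rightarrow> ('a \<times> 'a \<Rightarrow>\<^sub>0 'k) set \<Rightarrow> bool" where
  "skew_symmetric scale r \<longleftrightarrow> tensor_flip scale r = \<ominus>\<^sub>T r"

definition sharp ::
    "('k::field \<Rightarrow> 'a::ab_group_add \<Rightarrow> 'a) \<Rightarrow> ('a \<times> 'a \<Rightarrow>\<^sub>0 'k) set \<Rightarrow> ('a \<Rightarrow> 'k) \<Rightarrow> 'a" where
  "sharp scale r \<alpha> = the_elem ((\<lambda>x. free_ext scale (\<lambda>(a, b). scale (\<alpha> b) a) x) ` r)"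

section \<open>Associative Yang-Baxter pairs\<close>

definition bilinear_ext ::
    "('b \<Rightarrow> 'c \<Rightarrow> 'd) \<Rightarrow> ('b \<Rightarrow>\<^sub>0 'k::field) \<Rightarrow> ('c \<Rightarrow>\<^sub>0 'k) \<Rightarrow> ('d \<Rightarrow>\<^sub>0 'k)" where
  "bilinear_ext h x y = free_ext free_scale (\<lambda>p. free_ext free_scale (\<lambda>q. free_gen (h p q)) y) x"

definition tensor_prod ::
    "('k::field \<Rightarrow> 'a::ab_group_add \<Rightarrow> 'a) \<Rightarrow> ('a \<times> 'a \<Rightarrow> 'a \<times> 'a \<Rightarrow> 'a \<times> 'a \<times> 'a) \<Rightarrow>
       ('a \<times> 'a \<Rightarrow>\<^sub>0 'k) set \<Rightarrow> ('a \<times> 'a \<Rightarrow>\<^sub>0 'k) set \<Rightarrow> ('a \<times> 'a \<times> 'a \<Rightarrow>\<^sub>0 'k) set" where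
  "tensor_prod scale h r s = (\<Union>x\<in>r. \<Union>y\<in>s. coset_of (null3 scale) (bilinear_ext h x y))"

text \<open>\<open>tp_13_12 scale r s\<close> is $r_{13}s_{12}$, \<open>tp_12_23 scale r s\<close> is $r_{12}s_{23}$, and
  \<open>tp_23_13 scale r s\<close> is $r_{23}s_{13}$.\<close>

definition tp_13_12 ::
    "('k::field \<Rightarrow> 'a::ring \<Rightarrow> 'a) \<Rightarrow> ('a \<times> 'a \<Rightarrow>\<^sub>0 'k) set \<Rightarrow> ('a \<times> 'a \<Rightarrow>\<^sub>0 'k) set \<Rightarrow>
       ('a \<times> 'a \<times> 'a \<Rightarrow>\<^sub>0 'k) set" where
  "tp_13_12 scale = tensor_prod scale (\<lambda>(r1, r2) (s1, s2). (r1 * s1, s2, r2))"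

definition tp_12_23 ::
    "('k::field \<Rightarrow> 'a::ring \<Rightarrow> 'a) \<Rightarrow> ('a \<times> 'a \<Rightarrow>\<^sub>0 'k) set \<Rightarrow> ('a \<times> 'a \<Rightarrow>\<^sub>0 'k) set \<Rightarrow>
       ('a \<times> 'a \<times> 'a \<Rightarrow>\<^sub>0 'k) set" where
  "tp_12_23 scale = tensor_prod scale (\<lambda>(r1, r2) (s1, s2). (r1, r2 * s1, s2))"

definition tp_23_13 ::
    "('k::field \<Rightarrow> 'a::ring \<Rightarrow> 'a) \<Rightarrow> ('a \<times> 'a \<Rightarrow>\<^sub>0 'k) set \<Rightarrow> ('a \<times> 'a \<Rightarrow>\<^sub>0 'k) set \<Rightarrow>
       ('a \<times> 'a \<times> 'a \<Rightarrow>\<^sub>0 'k) set" where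
  "tp_23_13 scale = tensor_prod scale (\<lambda>(r1, r2) (s1, s2). (s1, r1, r2 * s2))"

definition assoc_YB_pair ::
    "('k::field \<Rightarrow> 'a::ring \<Rightarrow> 'a) \<Rightarrow>
       ('a \<times> 'a \<Rightarrow>\<^sub>0 'k) set \<Rightarrow> ('a \<times> 'a \<Rightarrow>\<^sub>0 'k) set \<Rightarrow> bool" where
  "assoc_YB_pair scale r s \<longleftrightarrow>
     tp_13_12 scale r r \<oplus>\<^sub>T \<ominus>\<^sub>T tp_12_23 scale r r \<oplus>\<^sub>T tp_23_13 scale s r = null3 scale \<and>
     tp_13_12 scale s r \<oplus>\<^sub>T \<ominus>\<^sub>T tp_12_23 scale s s \<oplus>\<^sub>T tp_23_13 scale s s = null3 scale"

section \<open>Independence of representatives\<close>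

lemma lookup_free_scale [simp]:
  "Poly_Mapping.lookup (free_scale c x) b = c * Poly_Mapping.lookup x b"
  by (simp add: free_scale_def Poly_Mapping.map.rep_eq when_def)

interpretation free: vector_space "free_scale :: 'k::field \<Rightarrow> ('b \<Rightarrow>\<^sub>0 'k) \<Rightarrow> _"
  by unfold_locales (auto intro!: poly_mapping_eqI simp: lookup_add algebra_simps)

context vector_space begin

lemma free_ext_superset:
  assumes "finite A" "Poly_Mapping.keys x \<subseteq> A"
  shows "free_ext scale g x = (\<Sum>b\<in>A. scale (Poly_Mapping.lookup x b) (g b))"
  unfolding free_ext_def using assms
  by (intro sum.mono_neutral_left) (auto simp: in_keys_iff)

end

lemma free_ext_linear:
  fixes sc :: "'k::field \<Rightarrow> 'v::ab_group_add \<Rightarrow> 'v"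
  assumes "vector_space sc"
  shows "Vector_Spaces.linear free_scale sc (free_ext sc g)"
proof -
  interpret V: vector_space sc by fact
  have add: "free_ext sc g (x + y) = free_ext sc g x + free_ext sc g y" for x y
  proof -
    let ?A = "Poly_Mapping.keys x \<union> Poly_Mapping.keys y"
    have "Poly_Mapping.keys (x + y) \<subseteq> ?A" by (rule Poly_Mapping.keys_add)
    then show ?thesis
      by (simp add: V.free_ext_superset[of ?A] lookup_add V.scale_left_distrib sum.distrib)
  qed
  have scale: "free_ext sc g (free_scale c x) = sc c (free_ext sc g x)" for c x
  proof -
    have "Poly_Mapping.keys (free_scale c x) \<subseteq> Poly_Mapping.keys x"
      by (auto simp: in_keys_iff)
    then show ?thesis
      by (simp add: V.free_ext_superset[of "Poly_Mapping.keys x"] V.scale_sum_right)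
  qed
  show ?thesis
    by unfold_locales (simp_all add: add scale)
qed

lemma free_ext_gen:
  fixes sc :: "'k::field \<Rightarrow> 'v::ab_group_add \<Rightarrow> 'v"
  assumes "vector_space sc"
  shows "free_ext sc g (free_gen b) = g b"
proof -
  interpret V: vector_space sc by fact
  show ?thesis by (simp add: free_ext_def free_gen_def)
qed

lemma linear_span_into:
  assumes "Vector_Spaces.linear s1 s2 T" "module.subspace s2 W" "\<And>x. x \<in> B \<Longrightarrow> T x \<in> W"
    and "x \<in> module.span s1 B"
  shows "T x \<in> W"
proof -
  interpret T: Vector_Spaces.linear s1 s2 T by fact
  have "T.vs1.span B \<subseteq> T -` W"
    using assms(2,3) by (intro T.vs1.span_minimal T.subspace_vimage) auto
  then show ?thesis using assms(4) by auto
qed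

lemma coset_of_eq_iff:
  fixes x y :: "'b \<Rightarrow>\<^sub>0 'k::field"
  assumes "module.subspace free_scale N"
  shows "coset_of N x = coset_of N y \<longleftrightarrow> x - y \<in> N"
proof
  assume "coset_of N x = coset_of N y"
  moreover have "x \<in> coset_of N x"
    using free.subspace_0[OF assms] by (simp add: coset_of_def)
  ultimately show "x - y \<in> N" by (simp add: coset_of_def)
next
  assume *: "x - y \<in> N"
  have "z - x \<in> N \<longleftrightarrow> z - y \<in> N" for z
    using free.subspace_add[OF assms _ *, of "z - x"] free.subspace_diff[OF assms _ *, of "z - y"]
    by auto
  then show "coset_of N x = coset_of N y" by (auto simp: coset_of_def)
qed

lemma coset_of_self:
  "module.subspace free_scale N \<Longrightarrow> x \<in> coset_of N (x :: 'b \<Rightarrow>\<^sub>0 'k::field)"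
  using free.subspace_0 by (auto simp: coset_of_def)

lemma subspace_null2: "module.subspace free_scale (null2 scale)"
  unfolding null2_def by (rule free.subspace_span)

lemma subspace_null3: "module.subspace free_scale (null3 scale)"
  unfolding null3_def by (rule free.subspace_span)

lemma free_ext_null2:
  fixes sc :: "'k::field \<Rightarrow> 'v::ab_group_add \<Rightarrow> 'v"
  assumes sc: "vector_space sc" and W: "module.subspace sc W"
    and "\<And>a a' b. g (a + a', b) - g (a, b) - g (a', b) \<in> W"
    and "\<And>a b b'. g (a, b + b') - g (a, b) - g (a, b') \<in> W"
    and "\<And>c a b. g (scale c a, b) - sc c (g (a, b)) \<in> W"
    and "\<And>c a b. g (a, scale c b) - sc c (g (a, b)) \<in> W"
    and "x \<in> null2 scale"
  shows "free_ext sc g x \<in> W"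
proof -
  interpret T: Vector_Spaces.linear free_scale sc "free_ext sc g" by (rule free_ext_linear[OF sc])
  show ?thesis
    using assms(7) unfolding null2_def
    by (rule linear_span_into[OF T.linear_axioms W, rotated])
      (use assms(3-6) in \<open>auto simp: bilinear_rels_def T.diff T.scale free_ext_gen[OF sc]\<close>)
qed

lemma bilinear_rels_null2:
  "free_gen (a + a', b) - free_gen (a, b) - free_gen (a', b) \<in> null2 scale"
  "free_gen (a, b + b') - free_gen (a, b) - free_gen (a, b') \<in> null2 scale"
  "free_gen (scale c a, b) - free_scale c (free_gen (a, b)) \<in> null2 scale"
  "free_gen (a, scale c b) - free_scale c (free_gen (a, b)) \<in> null2 scale"
  unfolding null2_def bilinear_rels_def by ((rule free.span_base, blast)+)

lemma tensor_flip_coset: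
  "tensor_flip scale (coset_of (null2 scale) x) =
     coset_of (null2 scale) (free_ext free_scale (\<lambda>(a, b). free_gen (b, a)) x)"
proof -
  let ?F = "free_ext free_scale (\<lambda>(a, b). free_gen (b, a))"
  interpret F: Vector_Spaces.linear free_scale free_scale ?F
    by (rule free_ext_linear[OF free.vector_space_axioms])
  have "?F z \<in> null2 scale" if "z \<in> null2 scale" for z
    by (rule free_ext_null2[OF free.vector_space_axioms subspace_null2 _ _ _ _ that])
      (simp_all add: bilinear_rels_null2)
  then have "coset_of (null2 scale) (?F y) = coset_of (null2 scale) (?F x)"
    if "y \<in> coset_of (null2 scale) x" for y
    using that unfolding coset_of_eq_iff[OF subspace_null2] by (simp add: coset_of_def flip: F.diff)
  then show ?thesis
    unfolding tensor_flip_def using coset_of_self[OF subspace_null2] by blast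
qed

lemma (in assoc_algebra) sharp_coset:
  assumes "\<alpha> \<in> dual_space scale"
  shows "sharp scale (coset_of (null2 scale) x) \<alpha> = free_ext scale (\<lambda>(a, b). scale (\<alpha> b) a) x"
proof -
  let ?F = "free_ext scale (\<lambda>(a, b). scale (\<alpha> b) a)"
  interpret F: Vector_Spaces.linear free_scale scale ?F
    by (rule free_ext_linear[OF vector_space_axioms])
  have "?F z \<in> {0}" if "z \<in> null2 scale" for z
    by (rule free_ext_null2[OF vector_space_axioms _ _ _ _ _ that])
      (use assms in \<open>auto simp: mem_dual_space_iff algebra_simps\<close>)
  then have "?F y = ?F x" if "y \<in> coset_of (null2 scale) x" for y
    using that F.diff[of y x] by (auto simp: coset_of_def)
  then have "?F ` coset_of (null2 scale) x = {?F x}"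
    using coset_of_self[OF subspace_null2] by blast
  then show ?thesis by (simp add: sharp_def)
qed

lemma bilinear_ext_null3_left:
  assumes "\<And>q a a' b. free_gen (h (a + a', b) q) - free_gen (h (a, b) q) - free_gen (h (a', b) q) \<in> null3 scale"
    and "\<And>q a b b'. free_gen (h (a, b + b') q) - free_gen (h (a, b) q) - free_gen (h (a, b') q) \<in> null3 scale"
    and "\<And>q c a b. free_gen (h (scale c a, b) q) - free_scale c (free_gen (h (a, b) q)) \<in> null3 scale"
    and "\<And>q c a b. free_gen (h (a, scale c b) q) - free_scale c (free_gen (h (a, b) q)) \<in> null3 scale"
    and "x \<in> null2 scale"
  shows "bilinear_ext h x y \<in> null3 scale"
proof -
  let ?g = "\<lambda>p. free_ext free_scale (\<lambda>q. free_gen (h p q)) y"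
  have add: "?g p - ?g p' - ?g p'' \<in> null3 scale"
    if "\<And>q. free_gen (h p q) - free_gen (h p' q) - free_gen (h p'' q) \<in> null3 scale" for p p' p''
  proof -
    have "(\<Sum>q\<in>Poly_Mapping.keys y. free_scale (Poly_Mapping.lookup y q)
        (free_gen (h p q) - free_gen (h p' q) - free_gen (h p'' q))) \<in> null3 scale"
      by (intro free.subspace_sum free.subspace_scale subspace_null3 that)
    then show ?thesis
      by (simp add: free_ext_def free.scale_right_diff_distrib sum_subtractf)
  qed
  have scale: "?g p - free_scale c (?g p') \<in> null3 scale"
    if "\<And>q. free_gen (h p q) - free_scale c (free_gen (h p' q)) \<in> null3 scale" for c p p'
  proof -
    have "(\<Sum>q\<in>Poly_Mapping.keys y. free_scale (Poly_Mapping.lookup y q)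
        (free_gen (h p q) - free_scale c (free_gen (h p' q)))) \<in> null3 scale"
      by (intro free.subspace_sum free.subspace_scale subspace_null3 that)
    then show ?thesis
      by (simp add: free_ext_def free.scale_right_diff_distrib sum_subtractf free.scale_sum_right
          mult.commute)
  qed
  show ?thesis
    unfolding bilinear_ext_def
    by (rule free_ext_null2[OF free.vector_space_axioms subspace_null3 _ _ _ _ assms(5)])
      (intro add scale assms(1-4))+
qed

lemma bilinear_ext_null3_right:
  assumes "\<And>p a a' b. free_gen (h p (a + a', b)) - free_gen (h p (a, b)) - free_gen (h p (a', b)) \<in> null3 scale"
    and "\<And>p a b b'. free_gen (h p (a, b + b')) - free_gen (h p (a, b)) - free_gen (h p (a, b')) \<in> null3 scale"
    and "\<And>p c a b. free_gen (h p (scale c a, b)) - free_scale c (free_gen (h p (a, b))) \<in> null3 scale"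
    and "\<And>p c a b. free_gen (h p (a, scale c b)) - free_scale c (free_gen (h p (a, b))) \<in> null3 scale"
    and "y \<in> null2 scale"
  shows "bilinear_ext h x y \<in> null3 scale"
proof -
  have "free_ext free_scale (\<lambda>q. free_gen (h p q)) y \<in> null3 scale" for p
    by (rule free_ext_null2[OF free.vector_space_axioms subspace_null3 _ _ _ _ assms(5)])
      (use assms(1-4) in auto)
  then show ?thesis
    unfolding bilinear_ext_def free_ext_def[of _ _ x]
    by (intro free.subspace_sum free.subspace_scale subspace_null3)
qed

lemma bilinear_ext_diff_left: "bilinear_ext h (x - x') y = bilinear_ext h x y - bilinear_ext h x' y"
proof -
  interpret F: Vector_Spaces.linear free_scale free_scale
    "free_ext free_scale (\<lambda>p. free_ext free_scale (\<lambda>q. free_gen (h p q)) y)"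
    by (rule free_ext_linear[OF free.vector_space_axioms])
  show ?thesis by (simp add: bilinear_ext_def F.diff)
qed

lemma bilinear_ext_diff_right: "bilinear_ext h x (y - y') = bilinear_ext h x y - bilinear_ext h x y'"
proof -
  have "free_ext free_scale (\<lambda>q. free_gen (h p q)) (y - y') =
      free_ext free_scale (\<lambda>q. free_gen (h p q)) y - free_ext free_scale (\<lambda>q. free_gen (h p q)) y'" for p
    by (rule module_hom.diff[OF free_ext_linear[OF free.vector_space_axioms,
        unfolded Vector_Spaces.linear_def, THEN conjunct2, THEN conjunct2]])
  then show ?thesis
    by (simp add: bilinear_ext_def free_ext_def[of _ _ x] free.scale_right_diff_distrib sum_subtractf)
qed

lemma tensor_prod_coset:
  assumes left: "\<And>x y. x \<in> null2 scale \<Longrightarrow> bilinear_ext h x y \<in> null3 scale"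
    and right: "\<And>x y. y \<in> null2 scale \<Longrightarrow> bilinear_ext h x y \<in> null3 scale"
  shows "tensor_prod scale h (coset_of (null2 scale) x) (coset_of (null2 scale) y) =
    coset_of (null3 scale) (bilinear_ext h x y)"
proof -
  have "coset_of (null3 scale) (bilinear_ext h x' y') = coset_of (null3 scale) (bilinear_ext h x y)"
    if "x' \<in> coset_of (null2 scale) x" "y' \<in> coset_of (null2 scale) y" for x' y'
  proof -
    have "bilinear_ext h (x' - x) y' + bilinear_ext h x (y' - y) \<in> null3 scale"
      using that by (intro free.subspace_add[OF subspace_null3] left right) (auto simp: coset_of_def)
    then show ?thesis
      by (simp add: coset_of_eq_iff[OF subspace_null3] bilinear_ext_diff_left bilinear_ext_diff_right)
  qed
  then have "tensor_prod scale h (coset_of (null2 scale) x) (coset_of (null2 scale) y) =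
      (\<Union>x'\<in>coset_of (null2 scale) x. \<Union>y'\<in>coset_of (null2 scale) y.
        coset_of (null3 scale) (bilinear_ext h x y))"
    unfolding tensor_prod_def by (intro SUP_cong refl)
  moreover have "x \<in> coset_of (null2 scale) x" "y \<in> coset_of (null2 scale) y"
    by (rule coset_of_self[OF subspace_null2])+
  ultimately show ?thesis by auto
qed

lemma trilinear_rels_null3:
  "free_gen (a + a', b, c) - free_gen (a, b, c) - free_gen (a', b, c) \<in> null3 scale"
  "free_gen (a, b + b', c) - free_gen (a, b, c) - free_gen (a, b', c) \<in> null3 scale"
  "free_gen (a, b, c + c') - free_gen (a, b, c) - free_gen (a, b, c') \<in> null3 scale"
  "free_gen (scale k a, b, c) - free_scale k (free_gen (a, b, c)) \<in> null3 scale"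
  "free_gen (a, scale k b, c) - free_scale k (free_gen (a, b, c)) \<in> null3 scale"
  "free_gen (a, b, scale k c) - free_scale k (free_gen (a, b, c)) \<in> null3 scale"
  subgoal unfolding null3_def trilinear_rels_def by (rule free.span_base, rule UnI1, rule UnI1, rule UnI1, rule UnI1, rule UnI1) blast
  subgoal unfolding null3_def trilinear_rels_def by (rule free.span_base, rule UnI1, rule UnI1, rule UnI1, rule UnI1, rule UnI2) blast
  subgoal unfolding null3_def trilinear_rels_def by (rule free.span_base, rule UnI1, rule UnI1, rule UnI1, rule UnI2) blast
  subgoal unfolding null3_def trilinear_rels_def by (rule free.span_base, rule UnI1, rule UnI1, rule UnI2) blast
  subgoal unfolding null3_def trilinear_rels_def by (rule free.span_base, rule UnI1, rule UnI2) blast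
  subgoal unfolding null3_def trilinear_rels_def by (rule free.span_base, rule UnI2) blast
  done

context assoc_algebra begin

lemma tp_13_12_coset:
  "tp_13_12 scale (coset_of (null2 scale) x) (coset_of (null2 scale) y) =
     coset_of (null3 scale) (bilinear_ext (\<lambda>(r1, r2) (s1, s2). (r1 * s1, s2, r2)) x y)"
  unfolding tp_13_12_def
proof (rule tensor_prod_coset, goal_cases)
  case (1 x y)
  show ?case
    by (rule bilinear_ext_null3_left[OF _ _ _ _ 1])
      (auto simp: distrib_left distrib_right trilinear_rels_null3
        simp flip: scale_mult_left scale_mult_right)
next
  case (2 x y)
  show ?case
    by (rule bilinear_ext_null3_right[OF _ _ _ _ 2])
      (auto simp: distrib_left distrib_right trilinear_rels_null3
        simp flip: scale_mult_left scale_mult_right)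
qed

lemma tp_12_23_coset:
  "tp_12_23 scale (coset_of (null2 scale) x) (coset_of (null2 scale) y) =
     coset_of (null3 scale) (bilinear_ext (\<lambda>(r1, r2) (s1, s2). (r1, r2 * s1, s2)) x y)"
  unfolding tp_12_23_def
proof (rule tensor_prod_coset, goal_cases)
  case (1 x y)
  show ?case
    by (rule bilinear_ext_null3_left[OF _ _ _ _ 1])
      (auto simp: distrib_left distrib_right trilinear_rels_null3
        simp flip: scale_mult_left scale_mult_right)
next
  case (2 x y)
  show ?case
    by (rule bilinear_ext_null3_right[OF _ _ _ _ 2])
      (auto simp: distrib_left distrib_right trilinear_rels_null3
        simp flip: scale_mult_left scale_mult_right)
qed

lemma tp_23_13_coset:
  "tp_23_13 scale (coset_of (null2 scale) x) (coset_of (null2 scale) y) =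
     coset_of (null3 scale) (bilinear_ext (\<lambda>(r1, r2) (s1, s2). (s1, r1, r2 * s2)) x y)"
  unfolding tp_23_13_def
proof (rule tensor_prod_coset, goal_cases)
  case (1 x y)
  show ?case
    by (rule bilinear_ext_null3_left[OF _ _ _ _ 1])
      (auto simp: distrib_left distrib_right trilinear_rels_null3
        simp flip: scale_mult_left scale_mult_right)
next
  case (2 x y)
  show ?case
    by (rule bilinear_ext_null3_right[OF _ _ _ _ 2])
      (auto simp: distrib_left distrib_right trilinear_rels_null3
        simp flip: scale_mult_left scale_mult_right)
qed

end

end

theory Submission
  imports Defs
begin

text \<open>Elements of the dual separate the points of \<open>A\<close> and decomposable functionals
  \<open>f \<otimes> g \<otimes> h\<close> separate the points of \<open>A \<otimes> A \<otimes> A\<close> (in any dimension, by a choice of basis), so each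
  of the four identities may be tested on triples of functionals. Write \<open>R\<close>, \<open>S\<close> for the maps
  attached to \<open>r\<close>, \<open>s\<close>. Pairing the Rota-Baxter identity for \<open>R(h) R(g)\<close> with \<open>f\<close> gives the value
  of the first Yang-Baxter expression on \<open>f \<otimes> g \<otimes> h\<close>, once skew-symmetry is used in the term
  containing \<open>s\<close>. Pairing the identity for \<open>S(h) S(g)\<close> with \<open>f\<close> gives the value of the second
  Yang-Baxter expression on the rotated functional \<open>g \<otimes> h \<otimes> f\<close>; here each of the three terms is
  matched by applying skew-symmetry of \<open>s\<close>.\<close>

section \<open>Linear extensions and pairings\<close>

lemma vector_space_mult: "vector_space ((*) :: 'k::field \<Rightarrow> 'k \<Rightarrow> 'k)"
  by unfold_locales (auto simp: algebra_simps)

lemma subspace_mult_zero: "module.subspace ((*) :: 'k::field \<Rightarrow> 'k \<Rightarrow> 'k) {0}"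
  using vector_space_mult[where 'k = 'k]
  by (simp add: module.subspace_single_0 module_iff_vector_space)

lemma linear_free_ext:
  assumes "Vector_Spaces.linear sc sc' T"
  shows "T (free_ext sc g x) = free_ext sc' (\<lambda>p. T (g p)) x"
proof -
  interpret T: Vector_Spaces.linear sc sc' T by fact
  show ?thesis by (simp add: free_ext_def T.sum T.scale)
qed

text \<open>This is implicit summation made precise: for a representative \<open>x\<close> of a
  tensor, \<open>pairing x (\<lambda>(a, b). F a b)\<close> is F(x_(1), x_(2)). It acts on
  representatives, so \<open>g\<close> may be any function.\<close>

definition pairing :: "('b \<Rightarrow>\<^sub>0 'k::field) \<Rightarrow> ('b \<Rightarrow> 'k) \<Rightarrow> 'k" where
  "pairing x g = free_ext (*) g x"

lemma linear_pairing: "Vector_Spaces.linear free_scale (*) (\<lambda>x. pairing x g)"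
  unfolding pairing_def by (rule free_ext_linear[OF vector_space_mult])

lemma pairing_arith:
  "pairing (x + y) g = pairing x g + pairing y g"
  "pairing (x - y) g = pairing x g - pairing y g"
  "pairing (free_scale c x) g = c * pairing x g"
proof -
  interpret T: Vector_Spaces.linear free_scale "(*)" "\<lambda>x. pairing x g" by (rule linear_pairing)
  show "pairing (x + y) g = pairing x g + pairing y g"
    "pairing (x - y) g = pairing x g - pairing y g"
    "pairing (free_scale c x) g = c * pairing x g"
    by (rule T.add T.diff T.scale)+
qed

lemma pairing_free_gen: "pairing (free_gen b) g = g b"
  unfolding pairing_def by (rule free_ext_gen[OF vector_space_mult])

lemma pairing_free_ext:
  "pairing (free_ext free_scale g x) f = pairing x (\<lambda>p. pairing (g p) f)"
  unfolding pairing_def[of x] by (rule linear_free_ext[OF linear_pairing])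

lemma pairing_bilinear_ext:
  "pairing (bilinear_ext h x y) f = pairing x (\<lambda>p. pairing y (\<lambda>q. f (h p q)))"
  by (simp add: bilinear_ext_def pairing_free_ext pairing_free_gen)

lemma pairing_sum: "pairing x g = (\<Sum>p\<in>Poly_Mapping.keys x. Poly_Mapping.lookup x p * g p)"
  by (simp add: pairing_def free_ext_def)

text \<open>Finite sums over independent copies of tensors may be exchanged.\<close>

lemma pairing_swap: "pairing x (\<lambda>p. pairing y (g p)) = pairing y (\<lambda>q. pairing x (\<lambda>p. g p q))"
  unfolding pairing_sum sum_distrib_left
  by (subst sum.swap) (simp add: mult.left_commute)

lemma pairing_add_right: "pairing x (\<lambda>p. g p + h p) = pairing x g + pairing x h"
  by (simp add: pairing_sum distrib_left sum.distrib)

lemma pairing_mult_left: "pairing x (\<lambda>p. c * g p) = c * pairing x g"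
  by (simp add: pairing_sum sum_distrib_left mult.left_commute)

lemma pairing_uminus_right: "pairing x (\<lambda>p. - g p) = - pairing x g"
  by (simp add: pairing_sum sum_negf)

section \<open>Tensor arithmetic on representatives\<close>

lemma coset_neg_coset_of:
  fixes x :: "'b \<Rightarrow>\<^sub>0 'k::field"
  assumes "module.subspace free_scale N"
  shows "\<ominus>\<^sub>T coset_of N x = coset_of N (- x)"
proof -
  have "- y \<in> coset_of N (- x) \<longleftrightarrow> y \<in> coset_of N x" for y
    using free.subspace_neg[OF assms, of "y - x"] free.subspace_neg[OF assms, of "x - y"]
    by (auto simp: coset_of_def)
  then have "z \<in> \<ominus>\<^sub>T coset_of N x \<longleftrightarrow> z \<in> coset_of N (- x)" for z
    unfolding coset_neg_def by (metis image_iff minus_minus)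
  then show ?thesis by blast
qed

lemma coset_add_coset_of:
  fixes x y :: "'b \<Rightarrow>\<^sub>0 'k::field"
  assumes "module.subspace free_scale N"
  shows "coset_of N x \<oplus>\<^sub>T coset_of N y = coset_of N (x + y)"
proof (intro equalityI subsetI)
  fix z assume "z \<in> coset_of N x \<oplus>\<^sub>T coset_of N y"
  then obtain a b where "z = a + b" "a - x \<in> N" "b - y \<in> N"
    by (auto simp: coset_add_def coset_of_def)
  then show "z \<in> coset_of N (x + y)"
    using free.subspace_add[OF assms, of "a - x" "b - y"] by (simp add: coset_of_def algebra_simps)
next
  fix z assume "z \<in> coset_of N (x + y)"
  then have "z - y \<in> coset_of N x"
    by (simp add: coset_of_def algebra_simps)
  moreover have "y \<in> coset_of N y" by (rule coset_of_self[OF assms])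
  ultimately show "z \<in> coset_of N x \<oplus>\<^sub>T coset_of N y"
    unfolding coset_add_def by force
qed

lemma coset_of_eq_subspace_iff:
  fixes x :: "'b \<Rightarrow>\<^sub>0 'k::field"
  assumes "module.subspace free_scale N"
  shows "coset_of N x = N \<longleftrightarrow> x \<in> N"
  using coset_of_eq_iff[OF assms, of x 0] by (simp add: coset_of_def)

section \<open>Separation by functionals\<close>

text \<open>The errors of a map that is linear only modulo \<open>W\<close> add up inside
  \<open>W\<close>. The intended map is \<open>free_gen\<close> in one slot, with \<open>W\<close>
  the trilinear relations.\<close>

lemma linear_mod_subspace_sum:
  assumes "vector_space sc" "vector_space sc'" and W: "module.subspace sc' W"
    and add: "\<And>a b. \<phi> (a + b) - \<phi> a - \<phi> b \<in> W"
    and scale: "\<And>c a. \<phi> (sc c a) - sc' c (\<phi> a) \<in> W"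
  shows "\<phi> (\<Sum>i\<in>I. sc (c i) (a i)) - (\<Sum>i\<in>I. sc' (c i) (\<phi> (a i))) \<in> W"
proof -
  interpret V: vector_space sc by fact
  interpret V': vector_space sc' by fact
  \<comment> \<open>This covers the empty sum and also an infinite \<open>I\<close>, over which both
    sums are 0 by convention.\<close>
  have zero: "\<phi> 0 \<in> W" using scale[of 0 0] by simp
  show ?thesis
  proof (induction I rule: infinite_finite_induct)
    case (insert i I)
    have "(\<phi> (sc (c i) (a i) + (\<Sum>i\<in>I. sc (c i) (a i))) - \<phi> (sc (c i) (a i))
          - \<phi> (\<Sum>i\<in>I. sc (c i) (a i)))
        + ((\<phi> (sc (c i) (a i)) - sc' (c i) (\<phi> (a i)))
        + (\<phi> (\<Sum>i\<in>I. sc (c i) (a i)) - (\<Sum>i\<in>I. sc' (c i) (\<phi> (a i))))) \<in> W"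
      by (intro V'.subspace_add[OF W] add scale insert.IH)
    then show ?case using insert.hyps by (simp add: algebra_simps)
  qed (simp_all add: zero)
qed

context assoc_algebra begin

definition some_basis :: "'a set" where "some_basis = extend_basis {}"

text \<open>The basis vector comes first, so that \<open>coord b\<close> is the functional dual to
  \<open>b\<close>; it vanishes identically when \<open>b\<close> lies outside the basis.\<close>

definition coord :: "'a \<Rightarrow> 'a \<Rightarrow> 'k" where "coord b a = representation some_basis a b"

lemma some_basis: "independent some_basis" "span some_basis = UNIV"
  unfolding some_basis_def
  by (simp_all add: independent_extend_basis span_extend_basis independent_empty)

lemma coord_dual: "coord b \<in> dual_space scale"
  by (simp add: mem_dual_space_iff coord_def representation_add representation_scale some_basis)

lemma coord_sum: "(\<Sum>b | coord b a \<noteq> 0. scale (coord b a) b) = a"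
  unfolding coord_def by (rule sum_nonzero_representation_eq) (simp_all add: some_basis)

lemma finite_coord: "finite {b. coord b a \<noteq> 0}"
  unfolding coord_def by (rule finite_representation)

lemma dual_separates:
  assumes "\<And>f. f \<in> dual_space scale \<Longrightarrow> f a = f b"
  shows "a = b"
proof -
  have "coord c a = coord c b" for c by (rule assms[OF coord_dual])
  then have "(\<Sum>c | coord c a \<noteq> 0. scale (coord c a) c) = (\<Sum>c | coord c b \<noteq> 0. scale (coord c b) c)"
    by (simp only:)
  then show ?thesis by (simp only: coord_sum)
qed

text \<open>Modulo the trilinear relations a generator can be expanded in the basis one slot at a
  time.\<close>

lemma free_gen_expand:
  "free_gen (a, b, c) -
    (\<Sum>i | coord i a \<noteq> 0. \<Sum>j | coord j b \<noteq> 0. \<Sum>k | coord k c \<noteq> 0.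
      free_scale (coord i a * coord j b * coord k c) (free_gen (i, j, k))) \<in> null3 scale"
proof -
  note lin = linear_mod_subspace_sum[OF vector_space_axioms free.vector_space_axioms subspace_null3]
  note W = free.subspace_sum[OF subspace_null3] free.subspace_scale[OF subspace_null3]
  have 1: "free_gen (a, b, c) - (\<Sum>i | coord i a \<noteq> 0. free_scale (coord i a) (free_gen (i, b, c)))
      \<in> null3 scale" for a b c
    using lin[of "\<lambda>a. free_gen (a, b, c)" scale "\<lambda>i. coord i a" "\<lambda>i. i" "{i. coord i a \<noteq> 0}"]
    by (simp add: coord_sum trilinear_rels_null3)
  have 2: "free_gen (a, b, c) - (\<Sum>i | coord i b \<noteq> 0. free_scale (coord i b) (free_gen (a, i, c)))
      \<in> null3 scale" for a b c
    using lin[of "\<lambda>b. free_gen (a, b, c)" scale "\<lambda>i. coord i b" "\<lambda>i. i" "{i. coord i b \<noteq> 0}"]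
    by (simp add: coord_sum trilinear_rels_null3)
  have 3: "free_gen (a, b, c) - (\<Sum>i | coord i c \<noteq> 0. free_scale (coord i c) (free_gen (a, b, i)))
      \<in> null3 scale" for a b c
    using lin[of "\<lambda>c. free_gen (a, b, c)" scale "\<lambda>i. coord i c" "\<lambda>i. i" "{i. coord i c \<noteq> 0}"]
    by (simp add: coord_sum trilinear_rels_null3)
  \<comment> \<open>A telescoping sum: the summands are the errors of expanding the first, second
    and third slot, and the intermediate sums cancel.\<close>
  have "(free_gen (a, b, c) - (\<Sum>i | coord i a \<noteq> 0. free_scale (coord i a) (free_gen (i, b, c))))
    + ((\<Sum>i | coord i a \<noteq> 0. free_scale (coord i a) (free_gen (i, b, c)
         - (\<Sum>j | coord j b \<noteq> 0. free_scale (coord j b) (free_gen (i, j, c)))))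
    + (\<Sum>i | coord i a \<noteq> 0. free_scale (coord i a) (\<Sum>j | coord j b \<noteq> 0. free_scale (coord j b)
         (free_gen (i, j, c) - (\<Sum>k | coord k c \<noteq> 0. free_scale (coord k c) (free_gen (i, j, k)))))))
    \<in> null3 scale"
    by (intro free.subspace_add[OF subspace_null3] W 1 2 3)
  then show ?thesis
    by (simp add: free.scale_right_diff_distrib sum_subtractf free.scale_sum_right mult.assoc)
qed

definition eval3 :: "('a \<Rightarrow> 'k) \<Rightarrow> ('a \<Rightarrow> 'k) \<Rightarrow> ('a \<Rightarrow> 'k) \<Rightarrow> 'a \<times> 'a \<times> 'a \<Rightarrow> 'k" where
  "eval3 f g h = (\<lambda>(a, b, c). f a * g b * h c)"

text \<open>A product of three functionals is trilinear, so it kills the generating relations and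
  hence their span.\<close>

lemma pairing_null3:
  assumes "f \<in> dual_space scale" "g \<in> dual_space scale" "h \<in> dual_space scale"
    and "z \<in> null3 scale"
  shows "pairing z (eval3 f g h) = 0"
proof -
  have add: "k (a + b) = k a + k b" and scale: "k (scale c a) = c * k a"
    if "k \<in> {f, g, h}" for k a b c
    using that assms(1-3) by (auto simp: mem_dual_space_iff)
  have "pairing w (eval3 f g h) \<in> {0}" if "w \<in> trilinear_rels scale" for w
    using that unfolding trilinear_rels_def
    by (elim UnE CollectE exE conjE; hypsubst)
      (simp_all add: pairing_arith pairing_free_gen eval3_def add scale algebra_simps)
  then show ?thesis
    using linear_span_into[OF linear_pairing subspace_mult_zero] assms(4) unfolding null3_def
    by blast
qed

text \<open>For the converse, expand every generator of \<open>z\<close> in the basis. This changes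
  \<open>z\<close> only by an element of \<open>null3 scale\<close>, and the coefficients of the
  result are values of \<open>z\<close> on triples of coordinate functionals, all zero by
  assumption.\<close>

lemma null3_iff:
  "z \<in> null3 scale \<longleftrightarrow> (\<forall>f\<in>dual_space scale. \<forall>g\<in>dual_space scale. \<forall>h\<in>dual_space scale.
     pairing z (eval3 f g h) = 0)"
proof
  assume z: "\<forall>f\<in>dual_space scale. \<forall>g\<in>dual_space scale. \<forall>h\<in>dual_space scale.
     pairing z (eval3 f g h) = 0"
  define P where "P = (\<lambda>(a, b, c). \<Sum>i | coord i a \<noteq> 0. \<Sum>j | coord j b \<noteq> 0. \<Sum>k | coord k c \<noteq> 0.
      free_scale (coord i a * coord j b * coord k c) (free_gen (i, j, k)))"
  have lookup_P: "Poly_Mapping.lookup (P p) (i, j, k) = eval3 (coord i) (coord j) (coord k) p" for p i j k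
  proof -
    obtain a b c where p: "p = (a, b, c)" by (cases p)
    \<comment> \<open>The nested conditionals are Kronecker deltas; an index outside the support
      contributes 0, which is also its coordinate.\<close>
    have "Poly_Mapping.lookup (P p) (i, j, k) =
      (\<Sum>i'\<in>{i. coord i a \<noteq> 0}. if i' = i then \<Sum>j'\<in>{j. coord j b \<noteq> 0}. if j' = j then
        \<Sum>k'\<in>{k. coord k c \<noteq> 0}. if k' = k then coord i' a * coord j' b * coord k' c else 0 else 0 else 0)"
      unfolding P_def p
      by (auto simp: lookup_sum free_gen_def lookup_single when_def intro!: sum.cong sum.neutral)
    also have "\<dots> = coord i a * coord j b * coord k c"
      by (auto simp: finite_coord)
    finally show ?thesis by (simp add: p eval3_def)
  qed
  have "free_ext free_scale P z = 0"
  proof (rule poly_mapping_eqI)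
    fix t :: "'a \<times> 'a \<times> 'a"
    obtain i j k where t: "t = (i, j, k)" by (cases t)
    have "Poly_Mapping.lookup (free_ext free_scale P z) t = pairing z (eval3 (coord i) (coord j) (coord k))"
      by (simp add: t free_ext_def lookup_sum lookup_P pairing_sum)
    then show "Poly_Mapping.lookup (free_ext free_scale P z) t = Poly_Mapping.lookup 0 t"
      using z by (simp add: coord_dual)
  qed
  moreover have "free_ext free_scale (\<lambda>p. free_gen p - P p) z \<in> null3 scale"
    unfolding free_ext_def
    by (intro free.subspace_sum[OF subspace_null3] free.subspace_scale[OF subspace_null3])
      (auto simp: P_def free_gen_expand)
  \<comment> \<open>Hence \<open>z\<close> is the sum of its expansion, which is 0, and the error,
    which lies in \<open>null3 scale\<close>.\<close>
  moreover have "free_ext free_scale free_gen z = z"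
    by (rule poly_mapping_eqI)
      (auto simp: free_ext_def lookup_sum free_gen_def lookup_single when_def in_keys_iff
        if_distrib[of "(*) _"] cong: if_cong)
  ultimately show "z \<in> null3 scale"
    by (simp add: free_ext_def free.scale_right_diff_distrib sum_subtractf)
qed (simp add: pairing_null3)

section \<open>Skew-symmetry and the sharp maps, tested on functionals\<close>

lemma dual_mult:
  assumes "f \<in> dual_space scale"
  shows "(\<lambda>a. f (a * b)) \<in> dual_space scale" "(\<lambda>a. f (b * a)) \<in> dual_space scale"
  using assms
  by (simp_all add: mem_dual_space_iff distrib_left distrib_right
      scale_mult_left[symmetric] scale_mult_right[symmetric])

text \<open>Skew-symmetry puts the flip of \<open>x\<close> plus \<open>x\<close> into
  \<open>null2 scale\<close>, where the bilinear function built from \<open>f\<close> and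
  \<open>g\<close> vanishes. It lets two functionals trade legs at the cost of a sign.\<close>

lemma skew_pairing:
  assumes "skew_symmetric scale (coset_of (null2 scale) x)"
    and "f \<in> dual_space scale" "g \<in> dual_space scale"
  shows "pairing x (\<lambda>(a, b). f a * g b) = - pairing x (\<lambda>(a, b). f b * g a)"
proof -
  let ?F = "free_ext free_scale (\<lambda>(a, b). free_gen (b, a)) x"
  have "?F - - x \<in> null2 scale"
    using assms(1) unfolding skew_symmetric_def tensor_flip_coset
      coset_neg_coset_of[OF subspace_null2] coset_of_eq_iff[OF subspace_null2] .
  then have "pairing (?F + x) (\<lambda>(a, b). f a * g b) \<in> {0}"
    unfolding pairing_def
    by (intro free_ext_null2[OF vector_space_mult subspace_mult_zero])
      (use assms(2,3) in \<open>auto simp: mem_dual_space_iff algebra_simps\<close>)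
  then show ?thesis
    by (simp add: pairing_arith pairing_free_ext case_prod_unfold pairing_free_gen
        eq_neg_iff_add_eq_0 add.commute)
qed

lemma dual_sharp:
  assumes "f \<in> dual_space scale" "\<alpha> \<in> dual_space scale"
  shows "f (sharp scale (coset_of (null2 scale) x) \<alpha>) = pairing x (\<lambda>(a, b). f a * \<alpha> b)"
proof -
  have f: "Vector_Spaces.linear scale (*) f" using assms(1) by (simp add: dual_space_def)
  have "f (sharp scale (coset_of (null2 scale) x) \<alpha>) = pairing x (\<lambda>p. f (scale (\<alpha> (snd p)) (fst p)))"
    using linear_free_ext[OF f] by (simp add: sharp_coset[OF assms(2)] pairing_def case_prod_unfold)
  then show ?thesis
    using assms(1) by (simp add: mem_dual_space_iff case_prod_unfold mult.commute)
qed

text \<open>Multiplication by \<open>c\<close> is absorbed into the functional, which stays in the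
  dual.\<close>

lemma dual_sharp_mult:
  assumes "f \<in> dual_space scale" "\<alpha> \<in> dual_space scale"
  shows "f (sharp scale (coset_of (null2 scale) x) \<alpha> * c) = pairing x (\<lambda>(a, b). f (a * c) * \<alpha> b)"
    and "f (c * sharp scale (coset_of (null2 scale) x) \<alpha>) = pairing x (\<lambda>(a, b). f (c * a) * \<alpha> b)"
  by (rule dual_sharp[OF dual_mult(1)[OF assms(1)] assms(2)]
      dual_sharp[OF dual_mult(2)[OF assms(1)] assms(2)])+

section \<open>Comparison of the identities\<close>

text \<open>With \<open>u = h\<close> and \<open>v = g\<close>, the product gives r_13 r_12, the
  left action gives r_12 r_23, and the right action gives s_23 r_13 after one flip of s; the sign of
  that flip turns the subtracted term into an added one.\<close>

lemma first_identity:
  fixes x y :: "'a \<times> 'a \<Rightarrow>\<^sub>0 'k"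
  defines "R \<equiv> sharp scale (coset_of (null2 scale) x)"
    and "S \<equiv> sharp scale (coset_of (null2 scale) y)"
  assumes skew: "skew_symmetric scale (coset_of (null2 scale) y)"
    and f: "f \<in> dual_space scale" and g: "g \<in> dual_space scale" and h: "h \<in> dual_space scale"
    and w: "coadj_left (R h) g + coadj_right h (S g) \<in> dual_space scale"
  shows "f (R h * R g) - f (R (coadj_left (R h) g + coadj_right h (S g))) =
    pairing (bilinear_ext (\<lambda>(r1, r2) (s1, s2). (r1 * s1, s2, r2)) x x
      - bilinear_ext (\<lambda>(r1, r2) (s1, s2). (r1, r2 * s1, s2)) x x
      + bilinear_ext (\<lambda>(r1, r2) (s1, s2). (s1, r1, r2 * s2)) y x) (eval3 f g h)"
proof -
  have "f (R h * R g) = pairing x (\<lambda>(a, b). pairing x (\<lambda>(c, d). f (a * c) * g d * h b))"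
    unfolding R_def
    by (subst dual_sharp_mult(1)[OF f h])
      (simp add: dual_sharp_mult(2)[OF f g] case_prod_unfold mult.commute[of _ "h _"] flip: pairing_mult_left)
  moreover have "f (R (coadj_left (R h) g + coadj_right h (S g))) =
     pairing x (\<lambda>(a, b). f a * g (b * R h)) + pairing x (\<lambda>(a, b). f a * h (S g * b))"
    unfolding R_def
    by (subst dual_sharp[OF f w[unfolded R_def]])
      (simp add: coadj_left_def coadj_right_def case_prod_unfold distrib_left pairing_add_right)
  moreover have "pairing x (\<lambda>(a, b). f a * g (b * R h)) =
      pairing x (\<lambda>(a, b). pairing x (\<lambda>(c, d). f a * g (b * c) * h d))"
    unfolding R_def
    by (simp add: dual_sharp_mult(2)[OF g h] case_prod_unfold mult.assoc
        flip: pairing_mult_left)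
  moreover have "pairing x (\<lambda>(a, b). f a * h (S g * b)) =
      - pairing y (\<lambda>(c, d). pairing x (\<lambda>(a, b). f a * g c * h (d * b)))"
  proof -
    \<comment> \<open>The flip moves \<open>g\<close> to the first leg of s, where s_23 r_13 has
      it.\<close>
    have "h (S g * b) = - pairing y (\<lambda>(c, d). g c * h (d * b))" for b
      unfolding S_def
      using skew_pairing[OF skew dual_mult(1)[OF h] g, of b]
      by (simp add: dual_sharp_mult(1)[OF h g] case_prod_unfold mult.commute)
    then show ?thesis
      unfolding case_prod_unfold
      by (subst pairing_swap[of y]) (simp add: pairing_uminus_right mult.assoc flip: pairing_mult_left)
  qed
  ultimately show ?thesis
    by (simp add: pairing_arith pairing_bilinear_ext case_prod_unfold eval3_def)
qed

text \<open>The rotation of the functional permutes the roles: the product now gives s_23 s_13, the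
  left action s_13 r_12 and the right action s_12 s_23.\<close>

lemma second_identity:
  fixes x y :: "'a \<times> 'a \<Rightarrow>\<^sub>0 'k"
  defines "R \<equiv> sharp scale (coset_of (null2 scale) x)"
    and "S \<equiv> sharp scale (coset_of (null2 scale) y)"
  assumes skew: "skew_symmetric scale (coset_of (null2 scale) y)"
    and f: "f \<in> dual_space scale" and g: "g \<in> dual_space scale" and h: "h \<in> dual_space scale"
    and w: "coadj_left (R h) g + coadj_right h (S g) \<in> dual_space scale"
  shows "f (S h * S g) - f (S (coadj_left (R h) g + coadj_right h (S g))) =
    pairing (bilinear_ext (\<lambda>(r1, r2) (s1, s2). (r1 * s1, s2, r2)) y x
      - bilinear_ext (\<lambda>(r1, r2) (s1, s2). (r1, r2 * s1, s2)) y y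
      + bilinear_ext (\<lambda>(r1, r2) (s1, s2). (s1, r1, r2 * s2)) y y) (eval3 g h f)"
proof -
  note skew = skew_pairing[OF skew]
  \<comment> \<open>Each factor is flipped once, so the signs cancel.\<close>
  have "f (S h * S g) = pairing y (\<lambda>(a, b). pairing y (\<lambda>(c, d). g c * h a * f (b * d)))"
  proof -
    have "f (S h * S g) = - pairing y (\<lambda>(a, b). h a * f (b * S g))"
      using skew[OF h dual_mult(1)[OF f], of "S g"] unfolding S_def
      by (simp add: dual_sharp_mult(1)[OF f h] case_prod_unfold mult.commute)
    moreover have "f (b * S g) = - pairing y (\<lambda>(c, d). g c * f (b * d))" for b
      using skew[OF g dual_mult(2)[OF f], of b] unfolding S_def
      by (simp add: dual_sharp_mult(2)[OF f g] case_prod_unfold mult.commute)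
    ultimately show ?thesis
      by (simp add: case_prod_unfold pairing_uminus_right mult.left_commute mult.assoc
          flip: pairing_mult_left)
  qed
  moreover have "f (S (coadj_left (R h) g + coadj_right h (S g))) =
     pairing y (\<lambda>(a, b). f a * g (b * R h)) + pairing y (\<lambda>(a, b). f a * h (S g * b))"
    unfolding S_def
    by (subst dual_sharp[OF f w[unfolded S_def]])
      (simp add: coadj_left_def coadj_right_def case_prod_unfold distrib_left pairing_add_right)
  \<comment> \<open>Only the outer copy of s is flipped, which leaves the sign that makes s_13 r_12
    positive in the difference.\<close>
  moreover have "pairing y (\<lambda>(a, b). f a * g (b * R h)) =
      - pairing y (\<lambda>(a, b). pairing x (\<lambda>(c, d). g (a * c) * h d * f b))"
    using skew[OF f dual_mult(1)[OF g], of "R h"] unfolding R_def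
    by (simp add: dual_sharp_mult(2)[OF g h] case_prod_unfold mult.commute[of _ "f _"]
        flip: pairing_mult_left)
  \<comment> \<open>The outer copy of s and the one inside \<open>S g\<close> are both flipped, so
    no sign remains.\<close>
  moreover have "pairing y (\<lambda>(a, b). f a * h (S g * b)) =
      pairing y (\<lambda>(a, b). pairing y (\<lambda>(c, d). g a * h (b * c) * f d))"
  proof -
    have "pairing y (\<lambda>(c, d). f c * h (S g * d)) = - pairing y (\<lambda>(c, d). f d * h (S g * c))"
      by (rule skew[OF f dual_mult(2)[OF h]])
    moreover have "h (S g * c) = - pairing y (\<lambda>(a, b). g a * h (b * c))" for c
      using skew[OF g dual_mult(1)[OF h], of c] unfolding S_def
      by (simp add: dual_sharp_mult(1)[OF h g] case_prod_unfold mult.commute)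
    ultimately show ?thesis
      unfolding case_prod_unfold
      by (subst pairing_swap) (simp add: pairing_uminus_right mult.commute[of _ "f _"]
          flip: pairing_mult_left)
  qed
  ultimately show ?thesis
    by (simp add: pairing_arith pairing_bilinear_ext case_prod_unfold eval3_def)
qed

lemma assoc_YB_pair_coset_iff:
  "assoc_YB_pair scale (coset_of (null2 scale) x) (coset_of (null2 scale) y) \<longleftrightarrow>
    bilinear_ext (\<lambda>(r1, r2) (s1, s2). (r1 * s1, s2, r2)) x x
      - bilinear_ext (\<lambda>(r1, r2) (s1, s2). (r1, r2 * s1, s2)) x x
      + bilinear_ext (\<lambda>(r1, r2) (s1, s2). (s1, r1, r2 * s2)) y x \<in> null3 scale \<and>
    bilinear_ext (\<lambda>(r1, r2) (s1, s2). (r1 * s1, s2, r2)) y x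
      - bilinear_ext (\<lambda>(r1, r2) (s1, s2). (r1, r2 * s1, s2)) y y
      + bilinear_ext (\<lambda>(r1, r2) (s1, s2). (s1, r1, r2 * s2)) y y \<in> null3 scale"
  unfolding assoc_YB_pair_def tp_13_12_coset tp_12_23_coset tp_23_13_coset
    coset_neg_coset_of[OF subspace_null3] coset_add_coset_of[OF subspace_null3]
    coset_of_eq_subspace_iff[OF subspace_null3]
  by simp

end

theorem proposition5p3:
  fixes scale :: "'k::field_char_0 \<Rightarrow> 'a::ring \<Rightarrow> 'a"
    and r s :: "('a \<times> 'a \<Rightarrow>\<^sub>0 'k) set"
  assumes "assoc_algebra scale"
    and "r \<in> tensor2 scale" and "s \<in> tensor2 scale"
    and "skew_symmetric scale r" and "skew_symmetric scale s"
  shows "assoc_YB_pair scale r s \<longleftrightarrow>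
    algebra_bimodule.generalized_RB_system scale dual_scale (dual_space scale)
      coadj_left coadj_right (sharp scale r) (sharp scale s)"
proof -
  interpret assoc_algebra scale by fact
  interpret B: algebra_bimodule scale dual_scale "dual_space scale" coadj_left coadj_right
    by (rule coadjoint_bimodule)
  obtain x y where r: "r = coset_of (null2 scale) x" and s: "s = coset_of (null2 scale) y"
    using assms(2,3) by (auto simp: tensor2_def)
  define R S where "R = sharp scale r" and "S = sharp scale s"
  let ?D = "dual_space scale"
  \<comment> \<open>Linearity belongs to the definition of a generalized Rota-Baxter system and
    holds for the map of any tensor; it is checked under functionals.\<close>
  have lin: "B.linear_on_M (sharp scale (coset_of (null2 scale) z))" for z
    unfolding B.linear_on_M_def
  proof (intro conjI ballI allI; rule dual_separates)
    fix u v f assume "u \<in> ?D" "v \<in> ?D" "f \<in> ?D"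
    moreover from this have "f (a + b) = f a + f b" for a b by (simp add: mem_dual_space_iff)
    moreover have "u + v \<in> ?D" using calculation B.V.subspace_add[OF B.subspace_M] by blast
    ultimately show "f (sharp scale (coset_of (null2 scale) z) (u + v)) =
        f (sharp scale (coset_of (null2 scale) z) u + sharp scale (coset_of (null2 scale) z) v)"
      by (simp add: dual_sharp case_prod_unfold distrib_left pairing_add_right)
  next
    fix c u f assume "u \<in> ?D" "f \<in> ?D"
    moreover from this have "f (scale c a) = c * f a" for a by (simp add: mem_dual_space_iff)
    moreover have "dual_scale c u \<in> ?D"
      using calculation B.V.subspace_scale[OF B.subspace_M] by blast
    ultimately show "f (sharp scale (coset_of (null2 scale) z) (dual_scale c u)) =
        f (scale c (sharp scale (coset_of (null2 scale) z) u))"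
      by (simp add: dual_sharp case_prod_unfold dual_scale_def mult.left_commute
          flip: pairing_mult_left)
  qed
  let ?w = "\<lambda>u v. coadj_left (R u) v + coadj_right u (S v)"
  have w: "?w u v \<in> ?D" if "u \<in> ?D" "v \<in> ?D" for u v
    using that by (intro B.V.subspace_add[OF B.subspace_M] B.lact_closed B.ract_closed)
  note id1 = first_identity[OF assms(5)[unfolded s], of _ _ _ x, folded r s, folded R_def S_def]
  note id2 = second_identity[OF assms(5)[unfolded s], of _ _ _ x, folded r s, folded R_def S_def]
  have separate: "a = b \<longleftrightarrow> (\<forall>f\<in>?D. f a - f b = 0)" for a b
    using dual_separates by auto
  \<comment> \<open>The quantifier order in the second conjunct follows the rotated functional in
    \<open>second_identity\<close>.\<close>
  have "assoc_YB_pair scale r s \<longleftrightarrow>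
     (\<forall>f\<in>?D. \<forall>g\<in>?D. \<forall>h\<in>?D. f (R h * R g) - f (R (?w h g)) = 0) \<and>
     (\<forall>g\<in>?D. \<forall>h\<in>?D. \<forall>f\<in>?D. f (S h * S g) - f (S (?w h g)) = 0)"
    unfolding r s assoc_YB_pair_coset_iff null3_iff by (simp add: id1 id2 w)
  also have "\<dots> \<longleftrightarrow> (\<forall>u\<in>?D. \<forall>v\<in>?D. R u * R v = R (?w u v)) \<and>
     (\<forall>u\<in>?D. \<forall>v\<in>?D. S u * S v = S (?w u v))"
    unfolding separate by blast
  also have "\<dots> \<longleftrightarrow> B.generalized_RB_system R S"
    using lin unfolding B.generalized_RB_system_def R_def S_def r s by blast
  finally show ?thesis by (simp add: R_def S_def)
qed

end
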